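(* Let $f:\mathbb{Z}_N\to\mathbb{C}$ be nonzero and let $\eta>0$. If $k$ is an integer with $$k>32\pi\left(\frac{\|\widehat f\|_1}{\|f\|_1}\right)^2\cdot\frac{N}{\eta^2},$$ then there exists a trigonometric polynomial $P$ of degree $k$ such that $$\|f-P\|_1<\eta\,\|f\|_1 .$$
   Context: $N$ is a positive integer, $\mathbb{Z}_N=\mathbb{Z}/N\mathbb{Z}$, $\chi(t)=e^{2\pi i t/N}$. For $f:\mathbb{Z}_N\to\mathbb{C}$ the unitary Fourier transform is $\widehat f(m)=N^{-1/2}\sum_{x\in\mathbb{Z}_N}\chi(-xm)f(x)$. $\|g\|_1=\sum_{x\in\mathbb{Z}_N}|g(x)|$. A trigonometric polynomial of degree $k$ means a function of the form $P(x)=\sum_{i=1}^k c_i\chi(m_i x)$ with $c_i\in\mathbb{C}$ and $m_i\in\mathbb{Z}_N$ (so the degree counts the number of terms). *)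

theory Defs
  imports "HOL-Analysis.Analysis" "HOL-Number_Theory.Residues"
begin

text \<open>
  Elements of \<open>\<int>/N\<int>\<close> are the canonical representatives \<open>0, \<dots>, N - 1\<close>, i.e. the carrier of
  \<^const>\<open>residue_ring\<close>. A function on \<open>\<int>/N\<int>\<close> is an HOL function of which only the
  values on this carrier matter.
\<close>

abbreviation Z_mod :: "nat \<Rightarrow> int set"
  where "Z_mod N \<equiv> carrier (residue_ring (int N))"

text \<open>
  The character is a function on the integers; by \<open>chi_mod\<close> below it descends to \<open>\<int>/N\<int>\<close>, so
  products such as \<open>m * x\<close> in its argument need not be reduced modulo \<open>N\<close>.
\<close>

definition chi :: "nat \<Rightarrow> int \<Rightarrow> complex"
  where "chi N t = exp (2 * of_real pi * \<i> * of_int t / of_nat N)"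

lemma chi_mod:
  assumes "N > 0"
  shows "chi N (t mod int N) = chi N t"
proof -
  have "(of_int t :: complex) = of_int (t mod int N) + of_nat N * of_int (t div int N)"
    by (metis mod_mult_div_eq of_int_add of_int_mult of_int_of_nat_eq)
  then have "2 * of_real pi * \<i> * of_int t / of_nat N =
      2 * of_real pi * \<i> * of_int (t mod int N) / of_nat N
        + \<i> * (of_int (t div int N) * (of_real pi * 2))"
    using assms by (simp add: field_simps)
  then show ?thesis
    by (simp only: chi_def exp_plus_2pin)
qed

definition fourier :: "nat \<Rightarrow> (int \<Rightarrow> complex) \<Rightarrow> int \<Rightarrow> complex"
  where "fourier N f m = (1 / of_real (sqrt (real N))) * (\<Sum>x\<in>Z_mod N. chi N (- (x * m)) * f x)"

definition norm1 :: "nat \<Rightarrow> (int \<Rightarrow> complex) \<Rightarrow> real"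
  where "norm1 N g = (\<Sum>x\<in>Z_mod N. cmod (g x))"

text \<open>
  The degree counts terms: frequencies may repeat and coefficients may vanish.
\<close>

definition trig_polynomial :: "nat \<Rightarrow> nat \<Rightarrow> (int \<Rightarrow> complex) \<Rightarrow> bool"
  where "trig_polynomial N k P \<longleftrightarrow>
    (\<exists>(c :: nat \<Rightarrow> complex) (m :: nat \<Rightarrow> int). (\<forall>i\<in>{1..k}. m i \<in> Z_mod N) \<and>
      (\<forall>x\<in>Z_mod N. P x = (\<Sum>i=1..k. c i * chi N (m i * x))))"

end

theory Submission
  imports Defs
begin

text \<open>
  By Fourier inversion \<open>f\<close> is a convex combination, with weights proportional to the
  \<open>cmod (fourier N f m)\<close>, of multiples of characters of equal modulus. Maurey's empirical method
  then approximates \<open>f\<close> in \<open>L\<^sup>2\<close> by an average of \<open>k\<close> of them with squared error at most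
  \<open>norm1 N (fourier N f) ^ 2 / k\<close>, and Cauchy--Schwarz passes to \<open>L\<^sup>1\<close>. The random sampling is
  replaced by a greedy choice: some next term does no worse than the average over all of them.
\<close>

text \<open>A variance identity: \<open>b - v j\<close> has weighted mean 0, so its cross term with
  \<open>r\<close> drops out. Only the square of \<open>r\<close> and the variance of
  \<open>v\<close> remain.\<close>

lemma convex_combination_norm_square:
  fixes v :: "'j \<Rightarrow> 'b::real_inner"
  assumes "sum w J = 1"
    and "b = (\<Sum>j\<in>J. w j *\<^sub>R v j)"
  shows "(\<Sum>j\<in>J. w j * (norm (r + (b - v j)))\<^sup>2)
    = (norm r)\<^sup>2 - (norm b)\<^sup>2 + (\<Sum>j\<in>J. w j * (norm (v j))\<^sup>2)"
proof -
  \<comment> \<open>Grouping as \<open>r + b\<close> minus \<open>v j\<close> leaves one term linear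
    in \<open>v j\<close>, which averages to an inner product with \<open>b\<close>.\<close>
  have "(norm (r + (b - v j)))\<^sup>2 =
      (norm (r + b))\<^sup>2 - 2 * inner (r + b) (v j) + (norm (v j))\<^sup>2" for j
    by (simp add: power2_norm_eq_inner algebra_simps inner_commute)
  then have "(\<Sum>j\<in>J. w j * (norm (r + (b - v j)))\<^sup>2) =
      (\<Sum>j\<in>J. w j * (norm (r + b))\<^sup>2 - 2 * inner (r + b) (w j *\<^sub>R v j) + w j * (norm (v j))\<^sup>2)"
    by (simp add: distrib_left right_diff_distrib mult.left_commute)
  also have "\<dots> = sum w J * (norm (r + b))\<^sup>2 - 2 * inner (r + b) b
      + (\<Sum>j\<in>J. w j * (norm (v j))\<^sup>2)"
    by (simp add: assms(2) sum.distrib sum_subtractf sum_distrib_left sum_distrib_right inner_sum_right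
        del: inner_scaleR_right)
  also have "\<dots> = (norm r)\<^sup>2 - (norm b)\<^sup>2 + (\<Sum>j\<in>J. w j * (norm (v j))\<^sup>2)"
    by (simp add: assms(1) power2_norm_eq_inner algebra_simps inner_commute)
  finally show ?thesis .
qed

lemma weighted_average_le_imp_exists:
  fixes w a :: "'j \<Rightarrow> real"
  assumes "finite J" "\<And>j. j \<in> J \<Longrightarrow> w j \<ge> 0" "sum w J = 1"
    and "(\<Sum>j\<in>J. w j * a j) \<le> c"
  shows "\<exists>j\<in>J. a j \<le> c"
proof (rule ccontr)
  assume "\<not> ?thesis"
  then have gt: "a j > c" if "j \<in> J" for j
    using that by force
  \<comment> \<open>Strictness of the averaged inequality needs one positive weight; the total being
    1 provides it.\<close>
  obtain j where j: "j \<in> J" "w j > 0"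
    using assms(2,3) by (metis less_eq_real_def sum.neutral zero_neq_one)
  have "(\<Sum>j\<in>J. w j * c) < (\<Sum>j\<in>J. w j * a j)"
    using assms(1,2) gt j
    by (intro sum_strict_mono_ex1 bexI[of _ j]) (auto intro: mult_left_mono less_imp_le)
  then show False
    using assms(3,4) by (simp flip: sum_distrib_right)
qed

text \<open>Working with \<open>k\<close> times \<open>f\<close> keeps the induction free of
  division: a new term adds \<open>f - v j\<close> to the residual. Averaged over \<open>j\<close>,
  this raises the squared error by at most \<open>C\<close>, so some \<open>j\<close> does
  too.\<close>

lemma maurey_empirical:
  fixes v :: "'j \<Rightarrow> 'x \<Rightarrow> 'b::real_inner"
  assumes J: "finite J" "\<And>j. j \<in> J \<Longrightarrow> w j \<ge> 0" "sum w J = 1"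
    and f: "\<And>x. x \<in> X \<Longrightarrow> f x = (\<Sum>j\<in>J. w j *\<^sub>R v j x)"
    and bound: "\<And>j. j \<in> J \<Longrightarrow> (\<Sum>x\<in>X. (norm (v j x))\<^sup>2) \<le> C"
  shows "\<exists>s. (\<forall>i. s i \<in> J) \<and>
    (\<Sum>x\<in>X. (norm (real k *\<^sub>R f x - (\<Sum>i=1..k. v (s i) x)))\<^sup>2) \<le> real k * C"
proof (induction k)
  case 0
  \<comment> \<open>Both sides of the bound are 0; \<open>j\<close> is only a default value for
    \<open>s\<close>.\<close>
  obtain j where "j \<in> J"
    using J(3) by fastforce
  then show ?case
    by (intro exI[of _ "\<lambda>_. j"]) auto
next
  case (Suc k)
  then obtain s where s: "\<forall>i. s i \<in> J"
    and IH: "(\<Sum>x\<in>X. (norm (real k *\<^sub>R f x - (\<Sum>i=1..k. v (s i) x)))\<^sup>2) \<le> real k * C"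
    by blast
  define R where "R x = real k *\<^sub>R f x - (\<Sum>i=1..k. v (s i) x)" for x
  \<comment> \<open>The variance identity acts at each point \<open>x\<close>, but one
    \<open>j\<close> must serve all points at once. Hence the error is averaged only after summing
    over \<open>x\<close>.\<close>
  have "(\<Sum>j\<in>J. w j * (\<Sum>x\<in>X. (norm (R x + (f x - v j x)))\<^sup>2)) =
      (\<Sum>x\<in>X. \<Sum>j\<in>J. w j * (norm (R x + (f x - v j x)))\<^sup>2)"
    unfolding sum_distrib_left by (rule sum.swap)
  also have "\<dots> = (\<Sum>x\<in>X. (norm (R x))\<^sup>2 - (norm (f x))\<^sup>2 + (\<Sum>j\<in>J. w j * (norm (v j x))\<^sup>2))"
    using f by (intro sum.cong refl convex_combination_norm_square J(3))
  also have "\<dots> \<le> (\<Sum>x\<in>X. (norm (R x))\<^sup>2 + (\<Sum>j\<in>J. w j * (norm (v j x))\<^sup>2))"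
    by (intro sum_mono) simp
  also have "\<dots> = (\<Sum>x\<in>X. (norm (R x))\<^sup>2) + (\<Sum>j\<in>J. w j * (\<Sum>x\<in>X. (norm (v j x))\<^sup>2))"
    unfolding sum.distrib sum_distrib_left by (subst sum.swap) (rule refl)
  also have "\<dots> \<le> real k * C + (\<Sum>j\<in>J. w j * C)"
    using IH J(2) bound unfolding R_def by (intro add_mono sum_mono mult_left_mono)
  also have "\<dots> = real (Suc k) * C"
    by (simp add: J(3) distrib_right flip: sum_distrib_right)
  finally have "\<exists>j\<in>J. (\<Sum>x\<in>X. (norm (R x + (f x - v j x)))\<^sup>2) \<le> real (Suc k) * C"
    by (intro weighted_average_le_imp_exists[of J w] J)
  then obtain j where j: "j \<in> J"
    and le: "(\<Sum>x\<in>X. (norm (R x + (f x - v j x)))\<^sup>2) \<le> real (Suc k) * C"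
    by blast
  \<comment> \<open>The update at \<open>Suc k\<close> lies outside \<open>{1..k}\<close>, so the
    earlier choices stay intact.\<close>
  have "R x + (f x - v j x) =
      real (Suc k) *\<^sub>R f x - (\<Sum>i=1..Suc k. v ((s(Suc k := j)) i) x)" for x
    by (simp add: R_def algebra_simps)
  with le j s show ?case
    by (intro exI[of _ "s(Suc k := j)"]) auto
qed

lemma Z_mod_eq: "N > 0 \<Longrightarrow> Z_mod N = int ` {..<N}"
  using image_int_atLeastLessThan[of 0 N] by (auto simp: residue_ring_def lessThan_atLeast0)

lemma finite_Z_mod [simp]: "finite (Z_mod N)"
  by (simp add: residue_ring_def)

lemma card_Z_mod: "card (Z_mod N) = N"
  by (simp add: residue_ring_def)

lemma cmod_chi [simp]: "cmod (chi N t) = 1"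
proof -
  have "chi N t = exp (\<i> * of_real (2 * pi * of_int t / of_nat N))"
    by (simp add: chi_def field_simps)
  then show ?thesis
    by (simp only: norm_exp_i_times)
qed

lemma chi_add: "chi N (s + t) = chi N s * chi N t"
  by (simp add: chi_def algebra_simps add_divide_distrib flip: exp_add)

lemma chi_of_nat_mult: "chi N (int n * t) = chi N t ^ n"
  by (simp add: chi_def mult_ac flip: exp_of_nat_mult)

lemma chi_eq_1_iff:
  assumes "N > 0"
  shows "chi N t = 1 \<longleftrightarrow> int N dvd t"
proof
  assume "chi N t = 1"
  then obtain n :: int where "2 * pi * of_int t / real N = of_int (2 * n) * pi"
    by (auto simp: chi_def exp_eq_1 Im_divide_of_nat)
  then have "real_of_int t = real_of_int (int N * n)"
    using assms by (simp add: field_simps)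
  then show "int N dvd t"
    by (metis dvd_triv_left of_int_eq_iff)
next
  assume "int N dvd t"
  then show "chi N t = 1"
    using chi_mod[OF assms, of t] by (simp add: chi_def)
qed

text \<open>Orthogonality of characters: a full geometric sum whose ratio is an \<open>N\<close>-th
  root of unity.\<close>

lemma sum_chi:
  assumes "N > 0"
  shows "(\<Sum>m\<in>Z_mod N. chi N (m * t)) = (if int N dvd t then of_nat N else 0)"
proof -
  have "(\<Sum>m\<in>Z_mod N. chi N (m * t)) = (\<Sum>n<N. chi N t ^ n)"
    by (simp add: Z_mod_eq[OF assms] sum.reindex chi_of_nat_mult)
  moreover have "chi N t ^ N = 1"
    by (simp add: chi_eq_1_iff[OF assms] flip: chi_of_nat_mult)
  ultimately show ?thesis
    unfolding chi_eq_1_iff[OF assms, symmetric] by (simp add: geometric_sum)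
qed

text \<open>Swapping the sums leaves the kernel of \<open>sum_chi\<close> at \<open>x - y\<close>,
  which is \<open>N\<close> at \<open>y = x\<close> and 0 elsewhere. The two factors
  \<open>1 / sqrt N\<close> cancel that \<open>N\<close>.\<close>

lemma fourier_inversion:
  assumes "N > 0" "x \<in> Z_mod N"
  shows "f x = (\<Sum>m\<in>Z_mod N. fourier N f m * chi N (m * x)) / of_real (sqrt (real N))"
proof -
  \<comment> \<open>Canonical representatives that are congruent modulo \<open>N\<close> are
    equal.\<close>
  have dvd: "int N dvd x - y \<longleftrightarrow> y = x" if "y \<in> Z_mod N" for y
    using that assms by (auto simp: residue_ring_def mod_eq_dvd_iff[symmetric])
  have "(\<Sum>m\<in>Z_mod N. \<Sum>y\<in>Z_mod N. chi N (- (y * m)) * f y * chi N (m * x)) =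
      (\<Sum>m\<in>Z_mod N. \<Sum>y\<in>Z_mod N. f y * chi N (m * (x - y)))"
  proof (intro sum.cong refl)
    fix m y
    have "chi N (m * (x - y)) = chi N (- (y * m)) * chi N (m * x)"
      by (simp add: algebra_simps flip: chi_add)
    then show "chi N (- (y * m)) * f y * chi N (m * x) = f y * chi N (m * (x - y))"
      by simp
  qed
  also have "\<dots> = (\<Sum>y\<in>Z_mod N. f y * (\<Sum>m\<in>Z_mod N. chi N (m * (x - y))))"
    by (subst sum.swap) (simp add: sum_distrib_left)
  also have "\<dots> = (\<Sum>y\<in>Z_mod N. if y = x then of_nat N * f y else 0)"
    by (intro sum.cong refl) (simp add: sum_chi[OF assms(1)] dvd)
  also have "\<dots> = of_nat N * f x"
    using assms(2) by simp
  finally have *: "(\<Sum>m\<in>Z_mod N. \<Sum>y\<in>Z_mod N. chi N (- (y * m)) * f y * chi N (m * x)) =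
      of_nat N * f x" .
  have sq: "complex_of_real (sqrt (real N)) * complex_of_real (sqrt (real N)) = of_nat N"
    by (simp flip: of_real_mult)
  have "(\<Sum>m\<in>Z_mod N. fourier N f m * chi N (m * x)) = of_nat N * f x / of_real (sqrt (real N))"
    unfolding fourier_def * [symmetric]
    by (simp add: sum_distrib_right sum_divide_distrib)
  then show ?thesis
    using assms(1) by (simp add: sq)
qed

lemma norm1_nonneg: "norm1 N g \<ge> 0"
  by (simp add: norm1_def sum_nonneg)

lemma norm1_eq_0_iff: "norm1 N g = 0 \<longleftrightarrow> (\<forall>x\<in>Z_mod N. g x = 0)"
  by (simp add: norm1_def sum_nonneg_eq_0_iff)

text \<open>Cauchy--Schwarz against the constant 1; its factor \<open>N\<close> is the one in the
  bound on \<open>k\<close>.\<close>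

lemma norm1_square_le: "(norm1 N g)\<^sup>2 \<le> real N * (\<Sum>x\<in>Z_mod N. (cmod (g x))\<^sup>2)"
  using Cauchy_Schwarz_ineq_sum[of "\<lambda>_. 1" "\<lambda>x. cmod (g x)" "Z_mod N"]
  by (simp add: norm1_def card_Z_mod)

lemma trig_polynomial_approximation:
  assumes "N > 0" "k > 0" "norm1 N (fourier N f) > 0"
  shows "\<exists>P. trig_polynomial N k P \<and>
    (norm1 N (\<lambda>x. f x - P x))\<^sup>2 \<le> (norm1 N (fourier N f))\<^sup>2 * real N / real k"
proof -
  define S where "S = norm1 N (fourier N f)"
  \<comment> \<open>With weights \<open>cmod (fourier N f m) / S\<close>, the coefficient
    \<open>c m\<close> must carry the phase and the remaining factor
    \<open>S / sqrt N\<close>.\<close>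
  define c where "c m = of_real (S / sqrt (real N)) * sgn (fourier N f m)" for m
  define v where "v m x = c m * chi N (m * x)" for m x
  have S: "S > 0"
    using assms(3) by (simp add: S_def)
  have f_eq: "f x = (\<Sum>m\<in>Z_mod N. (cmod (fourier N f m) / S) *\<^sub>R v m x)" if "x \<in> Z_mod N" for x
  proof -
    have "of_real (cmod z) * sgn z = z" for z :: complex
      by (simp add: sgn_eq)
    then have "fourier N f m * chi N (m * x) / of_real (sqrt (real N)) =
        (cmod (fourier N f m) / S) *\<^sub>R v m x" for m
      using S by (simp add: v_def c_def scaleR_conv_of_real field_simps)
    then show ?thesis
      by (subst fourier_inversion[OF assms(1) that]) (simp add: sum_divide_distrib)
  qed
  \<comment> \<open>Only an inequality, since \<open>sgn\<close> is 0 where the Fourier coefficient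
    vanishes. Summing the squares over \<open>N\<close> points gives the constant
    \<open>S\<^sup>2\<close> for Maurey's method.\<close>
  have "cmod (v m x) \<le> S / sqrt (real N)" for m x
    using S by (simp add: v_def c_def norm_mult norm_divide norm_sgn)
  then have "(\<Sum>x\<in>Z_mod N. (cmod (v m x))\<^sup>2) \<le> (\<Sum>x\<in>Z_mod N. (S / sqrt (real N))\<^sup>2)" for m
    by (intro sum_mono power_mono) auto
  also have "(\<Sum>x\<in>Z_mod N. (S / sqrt (real N))\<^sup>2) = S\<^sup>2"
    using assms(1) by (simp add: card_Z_mod power_divide)
  finally have bound: "(\<Sum>x\<in>Z_mod N. (cmod (v m x))\<^sup>2) \<le> S\<^sup>2" for m .
  have weights: "(\<Sum>m\<in>Z_mod N. cmod (fourier N f m) / S) = 1"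
    using S by (simp add: S_def norm1_def flip: sum_divide_distrib)
  obtain s where s: "\<forall>i. s i \<in> Z_mod N"
    and le: "(\<Sum>x\<in>Z_mod N. (cmod (real k *\<^sub>R f x - (\<Sum>i=1..k. v (s i) x)))\<^sup>2) \<le> real k * S\<^sup>2"
    using maurey_empirical[of "Z_mod N" "\<lambda>m. cmod (fourier N f m) / S" "Z_mod N" f v "S\<^sup>2" k]
      S weights f_eq bound by auto
  \<comment> \<open>The empirical mean of the sampled terms, so Maurey's residual is
    \<open>k\<close> times \<open>f - P\<close>. Repeated values of \<open>s\<close> are harmless
    because the degree counts terms.\<close>
  define P where "P x = (\<Sum>i=1..k. v (s i) x) / of_nat k" for x
  have "trig_polynomial N k P"
    unfolding trig_polynomial_def P_def v_def using s
    by (intro exI[of _ "\<lambda>i. c (s i) / of_nat k"] exI[of _ s]) (simp add: sum_divide_distrib)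
  moreover have "(norm1 N (\<lambda>x. f x - P x))\<^sup>2 \<le> S\<^sup>2 * real N / real k"
  proof -
    have "real k *\<^sub>R f x - (\<Sum>i=1..k. v (s i) x) = of_real (real k) * (f x - P x)" for x
      using assms(2) by (simp add: P_def scaleR_conv_of_real algebra_simps)
    then have "(cmod (real k *\<^sub>R f x - (\<Sum>i=1..k. v (s i) x)))\<^sup>2 =
        (real k)\<^sup>2 * (cmod (f x - P x))\<^sup>2" for x
      by (simp add: norm_mult power_mult_distrib)
    with le have "(real k)\<^sup>2 * (\<Sum>x\<in>Z_mod N. (cmod (f x - P x))\<^sup>2) \<le> real k * S\<^sup>2"
      by (simp add: sum_distrib_left)
    then have "(\<Sum>x\<in>Z_mod N. (cmod (f x - P x))\<^sup>2) \<le> S\<^sup>2 / real k"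
      using assms(2) by (simp add: field_simps power2_eq_square)
    then have "real N * (\<Sum>x\<in>Z_mod N. (cmod (f x - P x))\<^sup>2) \<le> real N * (S\<^sup>2 / real k)"
      by (intro mult_left_mono) auto
    with norm1_square_le[of N "\<lambda>x. f x - P x"] show ?thesis
      by (simp add: mult_ac)
  qed
  ultimately show ?thesis
    unfolding S_def by blast
qed

theorem theorem1p17:
  fixes N k :: nat and f :: "int \<Rightarrow> complex" and \<eta> :: real
  assumes "N > 0"
    and "\<exists>x\<in>Z_mod N. f x \<noteq> 0"
    and "\<eta> > 0"
    and "real k > 32 * pi * (norm1 N (fourier N f) / norm1 N f)\<^sup>2 * (real N / \<eta>\<^sup>2)"
  shows "\<exists>P. trig_polynomial N k P \<and> norm1 N (\<lambda>x. f x - P x) < \<eta> * norm1 N f"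
proof -
  define S where "S = norm1 N (fourier N f)"
  define F where "F = norm1 N f"
  have F: "F > 0"
    using assms(2) norm1_nonneg[of N f] norm1_eq_0_iff[of N f] unfolding F_def by force
  obtain x where x: "x \<in> Z_mod N" "f x \<noteq> 0"
    using assms(2) by blast
  \<comment> \<open>If all Fourier coefficients vanished, inversion would force
    \<open>f x = 0\<close>.\<close>
  have "S \<noteq> 0"
  proof
    assume "S = 0"
    then have "fourier N f m = 0" if "m \<in> Z_mod N" for m
      using that by (simp add: S_def norm1_eq_0_iff)
    then show False
      using x(2) by (subst (asm) fourier_inversion[OF assms(1) x(1)]) simp
  qed
  then have S: "S > 0"
    using norm1_nonneg[of N "fourier N f"] by (simp add: S_def)
  \<comment> \<open>The value of \<open>k\<close> at which the bound
    \<open>S\<^sup>2 * N / k\<close> equals \<open>(\<eta> * F)\<^sup>2\<close>. The hypothesis puts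
    \<open>k\<close> above it because \<open>32 * pi > 1\<close>.\<close>
  define q where "q = (S / F)\<^sup>2 * (real N / \<eta>\<^sup>2)"
  have "q > 0"
    using S F assms(1,3) by (simp add: q_def)
  moreover have "1 < 32 * pi"
    using pi_gt3 by simp
  ultimately have "q < 32 * pi * q"
    by simp
  also have "\<dots> < real k"
    using assms(4) by (simp add: q_def S_def F_def mult_ac)
  finally have q: "q < real k" .
  with \<open>q > 0\<close> have k: "k > 0"
    by (metis less_trans of_nat_0_less_iff)
  obtain P where P: "trig_polynomial N k P"
    and le: "(norm1 N (\<lambda>x. f x - P x))\<^sup>2 \<le> S\<^sup>2 * real N / real k"
    using trig_polynomial_approximation[OF assms(1) k S[unfolded S_def]] unfolding S_def by metis
  note le
  also have "S\<^sup>2 * real N / real k < (\<eta> * F)\<^sup>2"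
    using q k F assms(3) by (simp add: q_def field_simps)
  finally have "norm1 N (\<lambda>x. f x - P x) < \<eta> * F"
    using F assms(3) by (auto intro: power2_less_imp_less)
  with P show ?thesis
    unfolding F_def by blast
qed

end
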